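(* Let $\delta\in\mathbb C^\times$ and let $(\mathcal A,\ast,\circ)$ be a $(2\delta-1)$-mock-Novikov-Poisson algebra over $\mathbb C$. Define $\{x,y\}=x\circ y+y\circ x$ for $x,y\in\mathcal A$. Then $(\mathcal A,\ast,\{-,-\})$ is a transposed $\delta$-mock-Poisson algebra.
   Context: The ground field is $\mathbb C$; an algebra is a vector space with a bilinear product, not necessarily associative. For a scalar $\lambda$, a $\lambda$-mock-Novikov algebra is an algebra $(\mathcal A,\circ)$ such that for all $a,b,c\in\mathcal A$ $$\lambda(a\circ b)\circ c+\lambda(b\circ a)\circ c+a\circ(b\circ c)+b\circ(a\circ c)=0,\qquad (a\circ b)\circ c+(a\circ c)\circ b=0.$$ A $\lambda$-mock-Novikov-Poisson algebra is a triple $(\mathcal A,\ast,\circ)$ where $(\mathcal A,\ast)$ is anti-commutative ($x\ast y=-y\ast x$) and anti-associative ($(x\ast y)\ast z=-x\ast(y\ast z)$), $(\mathcal A,\circ)$ is a $\lambda$-mock-Novikov algebra, and for all $x,y,z\in\mathcal A$ $$(x\ast y)\circ z+x\ast(y\circ z)=0,$$ $$\lambda(x\circ y)\ast z+\lambda(y\circ x)\ast z+x\circ(y\ast z)+y\circ(x\ast z)=0.$$ A mock-Lie algebra is a vector space with a symmetric bilinear product $\{-,-\}$ satisfying $\{\{x,y\},z\}+\{\{y,z\},x\}+\{\{z,x\},y\}=0$. A transposed $\delta$-mock-Poisson algebra is a triple $(\mathcal A,\ast,\{-,-\})$ where $(\mathcal A,\ast)$ is anti-commutative and anti-associative, $(\mathcal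 A,\{-,-\})$ is a mock-Lie algebra, and for all $x,y,z\in\mathcal A$ $$-2\delta\,x\ast\{y,z\}=\{x\ast y,z\}+\{y,x\ast z\}.$$ *)

theory Defs
  imports Complex_Main
begin

locale nonassoc_algebra = vector_space scale
  for scale :: "complex \<Rightarrow> 'a::ab_group_add \<Rightarrow> 'a" +
  fixes mult :: "'a \<Rightarrow> 'a \<Rightarrow> 'a"
  assumes linear_right: "\<And>x. Vector_Spaces.linear scale scale (\<lambda>y. mult x y)"
    and linear_left: "\<And>y. Vector_Spaces.linear scale scale (\<lambda>x. mult x y)"

locale anticomm_antiassoc_algebra = nonassoc_algebra scale ast
  for scale :: "complex \<Rightarrow> 'a::ab_group_add \<Rightarrow> 'a"
    and ast :: "'a \<Rightarrow> 'a \<Rightarrow> 'a" (infixl "\<star>" 70) +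
  assumes anticommutative: "\<And>x y. x \<star> y = - (y \<star> x)"
    and antiassociative: "\<And>x y z. (x \<star> y) \<star> z = - (x \<star> (y \<star> z))"

locale mock_Novikov_algebra = nonassoc_algebra scale circ
  for scale :: "complex \<Rightarrow> 'a::ab_group_add \<Rightarrow> 'a"
    and lam :: complex
    and circ :: "'a \<Rightarrow> 'a \<Rightarrow> 'a" (infixl "\<odot>" 70) +
  assumes left_identity: "\<And>a b c.
      scale lam ((a \<odot> b) \<odot> c) + scale lam ((b \<odot> a) \<odot> c) + a \<odot> (b \<odot> c) + b \<odot> (a \<odot> c) = 0"
    and right_identity: "\<And>a b c. (a \<odot> b) \<odot> c + (a \<odot> c) \<odot> b = 0"

locale mock_Novikov_Poisson_algebra =
  anticomm_antiassoc_algebra scale ast + mock_Novikov_algebra scale lam circ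
  for scale :: "complex \<Rightarrow> 'a::ab_group_add \<Rightarrow> 'a"
    and lam :: complex
    and ast :: "'a \<Rightarrow> 'a \<Rightarrow> 'a" (infixl "\<star>" 70)
    and circ :: "'a \<Rightarrow> 'a \<Rightarrow> 'a" (infixl "\<odot>" 70) +
  assumes compat_right: "\<And>x y z. (x \<star> y) \<odot> z + x \<star> (y \<odot> z) = 0"
    and compat_left: "\<And>x y z.
      scale lam ((x \<odot> y) \<star> z) + scale lam ((y \<odot> x) \<star> z) + x \<odot> (y \<star> z) + y \<odot> (x \<star> z) = 0"

locale mock_Lie_algebra = nonassoc_algebra scale br
  for scale :: "complex \<Rightarrow> 'a::ab_group_add \<Rightarrow> 'a"
    and br :: "'a \<Rightarrow> 'a \<Rightarrow> 'a" +
  assumes symmetric: "\<And>x y. br x y = br y x"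
    and Jacobi: "\<And>x y z. br (br x y) z + br (br y z) x + br (br z x) y = 0"

locale transposed_mock_Poisson_algebra =
  anticomm_antiassoc_algebra scale ast + mock_Lie_algebra scale br
  for scale :: "complex \<Rightarrow> 'a::ab_group_add \<Rightarrow> 'a"
    and delta :: complex
    and ast :: "'a \<Rightarrow> 'a \<Rightarrow> 'a" (infixl "\<star>" 70)
    and br :: "'a \<Rightarrow> 'a \<Rightarrow> 'a" +
  assumes transposed_Leibniz: "\<And>x y z.
      scale (- 2 * delta) (x \<star> br y z) = br (x \<star> y) z + br y (x \<star> z)"

end

theory Submission
  imports Defs
begin

text \<open>Summing over all permutations, the right identity kills the left-normed products
  \<open>(a \<odot> b) \<odot> c\<close>; the left identity then kills the right-normed ones, which is the Jacobi identity
  of the symmetrized product. In the transposed Leibniz rule, the right compatibility law evaluates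
  the terms \<open>(x \<star> y) \<odot> z\<close> and \<open>(x \<star> z) \<odot> y\<close>, and the left one the remaining two, with
  coefficients adding up to \<open>-1 - (2\<delta> - 1) = -2\<delta>\<close>.\<close>

lemma (in nonassoc_algebra) add_right: "mult x (y + z) = mult x y + mult x z"
  using linear_right[of x] by (simp add: Vector_Spaces.linear_iff)

lemma (in nonassoc_algebra) add_left: "mult (x + y) z = mult x z + mult y z"
  using linear_left[of z] by (simp add: Vector_Spaces.linear_iff)

lemma (in nonassoc_algebra) minus_right: "mult x (- y) = - mult x y"
  by (metis add_right add_cancel_right_right eq_neg_iff_add_eq_0 neg_eq_iff_add_eq_0)

text \<open>With one argument fixed, the symmetrized product is the sum of a left and a right
  multiplication, both linear.\<close>

lemma (in nonassoc_algebra) nonassoc_algebra_symmetrized: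
  "nonassoc_algebra scale (\<lambda>x y. mult x y + mult y x)"
proof -
  interpret vector_space_pair scale scale ..
  show ?thesis
    by (intro nonassoc_algebra.intro nonassoc_algebra_axioms.intro vector_space_axioms
        linear_compose_add linear_right linear_left)
qed

lemma (in mock_Novikov_algebra) mock_Lie_algebra_symmetrized:
  "mock_Lie_algebra scale (\<lambda>x y. x \<odot> y + y \<odot> x)"
proof -
  interpret br: nonassoc_algebra scale "\<lambda>x y. x \<odot> y + y \<odot> x"
    by (rule nonassoc_algebra_symmetrized)
  show ?thesis
  proof
    fix x y z
    show "x \<odot> y + y \<odot> x = y \<odot> x + x \<odot> y"
      by (rule add.commute)
    \<comment> \<open>The Jacobi sum expands into twelve products: \<open>S\<close> collects the six
      left-normed ones, \<open>T\<close> the six right-normed ones.\<close>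
    define S where "S = (x \<odot> y) \<odot> z + (y \<odot> x) \<odot> z + (y \<odot> z) \<odot> x + (z \<odot> y) \<odot> x
      + (z \<odot> x) \<odot> y + (x \<odot> z) \<odot> y"
    define T where "T = x \<odot> (y \<odot> z) + y \<odot> (x \<odot> z) + y \<odot> (z \<odot> x) + z \<odot> (y \<odot> x)
      + z \<odot> (x \<odot> y) + x \<odot> (z \<odot> y)"
    \<comment> \<open>Each pair shares its leftmost factor and exchanges the other two, so
      \<open>right_identity\<close> cancels it.\<close>
    have "S = ((x \<odot> y) \<odot> z + (x \<odot> z) \<odot> y) + ((y \<odot> x) \<odot> z + (y \<odot> z) \<odot> x)
      + ((z \<odot> x) \<odot> y + (z \<odot> y) \<odot> x)"
      by (simp add: S_def algebra_simps)
    then have S: "S = 0"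
      by (simp add: right_identity)
    \<comment> \<open>The rows are \<open>left_identity\<close> at the cyclic shifts of (x, y,
      z).\<close>
    have "scale lam S + T =
       (scale lam ((x \<odot> y) \<odot> z) + scale lam ((y \<odot> x) \<odot> z) + x \<odot> (y \<odot> z) + y \<odot> (x \<odot> z))
     + (scale lam ((y \<odot> z) \<odot> x) + scale lam ((z \<odot> y) \<odot> x) + y \<odot> (z \<odot> x) + z \<odot> (y \<odot> x))
     + (scale lam ((z \<odot> x) \<odot> y) + scale lam ((x \<odot> z) \<odot> y) + z \<odot> (x \<odot> y) + x \<odot> (z \<odot> y))"
      by (simp add: S_def T_def scale_right_distrib algebra_simps)
    then have T: "T = 0"
      by (simp add: left_identity S)
    have "(x \<odot> y + y \<odot> x) \<odot> z + z \<odot> (x \<odot> y + y \<odot> x)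
      + ((y \<odot> z + z \<odot> y) \<odot> x + x \<odot> (y \<odot> z + z \<odot> y))
      + ((z \<odot> x + x \<odot> z) \<odot> y + y \<odot> (z \<odot> x + x \<odot> z)) = S + T"
      by (simp add: S_def T_def add_left add_right algebra_simps)
    then show "(x \<odot> y + y \<odot> x) \<odot> z + z \<odot> (x \<odot> y + y \<odot> x)
      + ((y \<odot> z + z \<odot> y) \<odot> x + x \<odot> (y \<odot> z + z \<odot> y))
      + ((z \<odot> x + x \<odot> z) \<odot> y + y \<odot> (z \<odot> x + x \<odot> z)) = 0"
      by (simp add: S T)
  qed
qed

text \<open>For general \<open>lam\<close> the two sources of the coefficient stay visible:
  \<open>compat_right\<close> contributes -1 and \<open>compat_left\<close> contributes
  \<open>- lam\<close>.\<close>

lemma (in mock_Novikov_Poisson_algebra) transposed_Leibniz_symmetrized: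
  "scale (- 1 - lam) (x \<star> (y \<odot> z + z \<odot> y))
    = ((x \<star> y) \<odot> z + z \<odot> (x \<star> y)) + (y \<odot> (x \<star> z) + (x \<star> z) \<odot> y)"
proof -
  \<comment> \<open>Both products inherit facts of the same names from
    \<open>nonassoc_algebra\<close>, so each instance is selected explicitly.\<close>
  note star_add_right = anticomm_antiassoc_algebra.axioms(1)
    [OF anticomm_antiassoc_algebra_axioms, THEN nonassoc_algebra.add_right]
  note circ_minus_right = mock_Novikov_algebra.axioms(1)
    [OF mock_Novikov_algebra_axioms, THEN nonassoc_algebra.minus_right]
  have right: "(x \<star> a) \<odot> b = - (x \<star> (a \<odot> b))" for a b
    using compat_right[of x a b] by (simp add: eq_neg_iff_add_eq_0)
  \<comment> \<open>In \<open>compat_left\<close> the two symmetrized arguments are y and z, so x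
    must first move to the last place, at the cost of a sign.\<close>
  have "y \<odot> (x \<star> z) + z \<odot> (x \<star> y) = - (y \<odot> (z \<star> x) + z \<odot> (y \<star> x))"
    by (simp add: anticommutative[of x] circ_minus_right)
  also have "\<dots> = scale lam ((y \<odot> z) \<star> x) + scale lam ((z \<odot> y) \<star> x)"
    using compat_left[of y z x] by (intro minus_unique) (simp add: algebra_simps)
  \<comment> \<open>Moving x back to the front costs a second sign.\<close>
  also have "\<dots> = - scale lam (x \<star> (y \<odot> z + z \<odot> y))"
    by (simp add: anticommutative[of _ x] star_add_right scale_right_distrib)
  finally have left: "y \<odot> (x \<star> z) + z \<odot> (x \<star> y) = - scale lam (x \<star> (y \<odot> z + z \<odot> y))" .
  have "((x \<star> y) \<odot> z + z \<odot> (x \<star> y)) + (y \<odot> (x \<star> z) + (x \<star> z) \<odot> y)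
    = - (x \<star> (y \<odot> z + z \<odot> y)) + (y \<odot> (x \<star> z) + z \<odot> (x \<star> y))"
    by (simp add: right star_add_right algebra_simps)
  then show ?thesis
    by (simp add: left scale_left_diff_distrib)
qed

theorem theorem6p8:
  fixes scale :: "complex \<Rightarrow> 'a::ab_group_add \<Rightarrow> 'a"
    and delta :: complex
    and ast circ :: "'a \<Rightarrow> 'a \<Rightarrow> 'a"
  assumes "delta \<noteq> 0"
    and "mock_Novikov_Poisson_algebra scale (2 * delta - 1) ast circ"
  shows "transposed_mock_Poisson_algebra scale delta ast (\<lambda>x y. circ x y + circ y x)"
proof -
  interpret mock_Novikov_Poisson_algebra scale "2 * delta - 1" ast circ
    by (fact assms(2))
  interpret br: mock_Lie_algebra scale "\<lambda>x y. circ x y + circ y x"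
    by (rule mock_Lie_algebra_symmetrized)
  show ?thesis
    using transposed_Leibniz_symmetrized by unfold_locales simp
qed

end
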